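(* Let $b_1,b_2$ be nonzero real numbers and let $y_1,y_2$ be real numbers. For all integers $n,m\ge 0$ and all real $x$, $$\sum_{a=0}^{n}(-1)^{a}\binom{m+n+1}{n-a}b_1^{a}b_2^{-a-1}B_{n-a}(b_1x+y_1)B_{m+a+1}(b_2x+y_2)-\sum_{a=0}^{m}(-1)^{a}\binom{m+n+1}{m-a}b_2^{a}b_1^{-a-1}B_{m-a}(b_2x+y_2)B_{n+a+1}(b_1x+y_1)$$ $$=\frac{(-1)^{m+1}}{b_1^{m+1}b_2^{n+1}}\sum_{a=0}^{m+n+1}(-1)^{a}\binom{m+n+1}{a}b_1^{a}b_2^{m+n+1-a}B_{m+n+1-a}(y_1)B_{a}(y_2).$$
   Context: $B_n(x)$ denotes the $n$th Bernoulli polynomial, defined by $\frac{te^{xt}}{e^t-1}=\sum_{n\ge0}B_n(x)\frac{t^n}{n!}$ ($|t|<2\pi$). *)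

theory Defs
  imports "HOL-Complex_Analysis.Complex_Analysis"
begin

text \<open>
  The generating function is read as a quotient of formal power series; the denominator has
  subdegree 1, so the quotient is exact. \<open>bernpoly_sums\<close> below recovers the convergent
  expansion for \<open>\<bar>t\<bar> < 2\<pi>\<close>. At the removable singularity \<open>t = 0\<close>, where HOL's \<open>0 / 0 = 0\<close>
  gives the wrong value, the function is continued by 1.
\<close>

definition bernpoly :: "nat \<Rightarrow> real \<Rightarrow> real" where
  "bernpoly n x = fact n * fps_nth (fps_X * fps_exp x / (fps_exp 1 - 1)) n"

lemma bernpoly_fps_real:
  "Abs_fps (\<lambda>n. bernpoly n x / fact n) * (fps_exp 1 - 1) = fps_X * fps_exp x"
proof -
  have "subdegree (fps_exp 1 - 1 :: real fps) = 1"
    by (rule subdegreeI) auto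
  moreover have "subdegree (fps_X * fps_exp x :: real fps) \<ge> 1"
    by (rule subdegree_geI) (auto simp: fps_eq_iff dest: spec[of _ 1])
  moreover have "(fps_exp 1 - 1 :: real fps) \<noteq> 0"
    using calculation(1) by auto
  ultimately have "(fps_exp 1 - 1) dvd (fps_X * fps_exp x :: real fps)"
    by (subst fps_dvd_iff) (auto simp: fps_eq_iff dest: spec[of _ 1])
  moreover have "Abs_fps (\<lambda>n. bernpoly n x / fact n) = fps_X * fps_exp x / (fps_exp 1 - 1)"
    by (simp add: bernpoly_def fps_eq_iff)
  ultimately show ?thesis
    by simp
qed

lemma bernpoly_fps_complex:
  "Abs_fps (\<lambda>n. of_real (bernpoly n x / fact n)) * (fps_exp 1 - 1) =
     (fps_X * fps_exp (of_real x) :: complex fps)"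
proof (rule fps_ext)
  fix n
  have "fps_nth (Abs_fps (\<lambda>n. of_real (bernpoly n x / fact n)) * (fps_exp 1 - 1)) n =
          (of_real (fps_nth (Abs_fps (\<lambda>n. bernpoly n x / fact n) * (fps_exp 1 - 1)) n) :: complex)"
    unfolding fps_mult_nth of_real_sum
    by (intro sum.cong) auto
  also have "\<dots> = fps_nth (fps_X * fps_exp (of_real x)) n"
    by (subst bernpoly_fps_real) simp
  finally show "fps_nth (Abs_fps (\<lambda>n. of_real (bernpoly n x / fact n)) * (fps_exp 1 - 1)) n =
                  (fps_nth (fps_X * fps_exp (of_real x)) n :: complex)" .
qed

lemma exp_neq_1_complex:
  fixes t :: complex
  assumes "t \<noteq> 0" "norm t < 2 * pi"
  shows "exp t \<noteq> 1"
proof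
  assume "exp t = 1"
  then obtain k :: int where k: "Re t = 0" "Im t = of_int (2 * k) * pi"
    by (auto simp: exp_eq_1)
  with assms(1) have "k \<noteq> 0"
    by (auto simp: complex_eq_iff)
  hence "2 * pi * 1 \<le> 2 * pi * \<bar>real_of_int k\<bar>"
    by (intro mult_left_mono) auto
  also have "\<dots> = \<bar>Im t\<bar>"
    using k by (simp add: abs_mult)
  also have "\<dots> \<le> norm t"
    by (rule abs_Im_le_cmod)
  finally show False
    using assms(2) by simp
qed

theorem bernpoly_sums:
  fixes t :: complex
  assumes t: "norm t < 2 * pi"
  shows "(\<lambda>n. of_real (bernpoly n x) * t ^ n / fact n) sums
           (if t = 0 then 1 else t * exp (of_real x * t) / (exp t - 1))"
proof -
  define G :: "complex fps" where "G = Abs_fps (\<lambda>n. of_real (bernpoly n x / fact n))"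
  define f where
    "f = (\<lambda>t::complex. if t = 0 then 1 else t * exp (of_real x * t) / (exp t - 1))"
  have sd: "subdegree (fps_exp 1 - 1 :: complex fps) = 1"
    by (rule subdegreeI) auto
  hence nz: "(fps_exp 1 - 1 :: complex fps) \<noteq> 0"
    by auto
  have G: "G = fps_X * fps_exp (of_real x) / (fps_exp 1 - 1)"
    using bernpoly_fps_complex[of x] nz unfolding G_def
    by (metis nonzero_mult_div_cancel_right)
  have exp: "f has_fps_expansion G"
    unfolding G f_def
  proof (rule has_fps_expansion_divide)
    show "(\<lambda>t. t * exp (of_real x * t)) has_fps_expansion
            (fps_X * fps_exp (of_real x) :: complex fps)"
      by (intro fps_expansion_intros)
    show "(\<lambda>t. exp t - 1) has_fps_expansion (fps_exp 1 - 1 :: complex fps)"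
      by (intro fps_expansion_intros)
    show "1 = fps_nth (fps_X * fps_exp (of_real x) :: complex fps)
                (subdegree (fps_exp 1 - 1 :: complex fps)) /
              fps_nth (fps_exp 1 - 1) (subdegree (fps_exp 1 - 1 :: complex fps))"
      unfolding sd by simp
    show "subdegree (fps_exp 1 - 1 :: complex fps) \<le> subdegree (fps_X * fps_exp (complex_of_real x))"
      unfolding sd by (rule subdegree_geI) (auto simp: fps_eq_iff dest: spec[of _ 1])
  qed (use nz in auto)
  have "f holomorphic_on ball 0 (2 * pi)"
  proof (rule no_isolated_singularity')
    show "(f \<longlongrightarrow> f z) (at z within ball 0 (2 * pi))" if "z \<in> {0}" for z
      using has_fps_expansion_imp_continuous[OF exp, of UNIV] that
      by (auto simp: continuous_within intro: Lim_at_imp_Lim_at_within)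
    have "(\<lambda>t. t * exp (of_real x * t) / (exp t - 1)) holomorphic_on ball 0 (2 * pi) - {0}"
      by (intro holomorphic_intros) (auto dest!: exp_neq_1_complex)
    thus "f holomorphic_on ball 0 (2 * pi) - {0}"
      by (rule holomorphic_transform) (auto simp: f_def)
  qed auto
  hence "(\<lambda>n. fps_nth G n * t ^ n) sums f t"
    using has_fps_expansion_imp_sums_complex[OF exp, of "ereal (2 * pi)" t] t
    by simp
  thus ?thesis
    by (simp add: G_def f_def)
qed

end

theory Submission
  imports Defs
begin

text \<open>
  Put \<open>N = m + n + 1\<close>, and let \<open>S(x)\<close> be the sum over \<open>k = 0, \<dots>, N\<close> of
  \<open>(-1)\<^sup>k (N choose k) b\<^sub>1\<^sup>k b\<^sub>2\<^sup>N\<^sup>-\<^sup>k B\<^sub>N\<^sub>-\<^sub>k(b\<^sub>1 x + y\<^sub>1) B\<^sub>k(b\<^sub>2 x + y\<^sub>2)\<close>.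
  With \<open>k = m + 1 + a\<close> in the first sum and \<open>k = m - a\<close> in the second, the left-hand side
  becomes, up to the factor \<open>(-1)\<^sup>m\<^sup>+\<^sup>1 / (b\<^sub>1\<^sup>m\<^sup>+\<^sup>1 b\<^sub>2\<^sup>n\<^sup>+\<^sup>1)\<close>, the part of \<open>S(x)\<close> with \<open>k > m\<close> plus
  the part with \<open>k \<le> m\<close>. The right-hand side is the same factor times \<open>S(0)\<close>, so the claim is
  that \<open>S\<close> is constant.

  If \<open>F(t, x)\<close> is the exponential generating function of the \<open>B\<^sub>n(x)\<close>, then \<open>S(x) / N!\<close> is the
  coefficient of \<open>t\<^sup>N\<close> in \<open>F(b\<^sub>2 t, b\<^sub>1 x + y\<^sub>1) F(- b\<^sub>1 t, b\<^sub>2 x + y\<^sub>2)\<close>. As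
  \<open>F(t, x + h) = F(t, x) e\<^sup>h\<^sup>t\<close>, the parameter \<open>x\<close> contributes \<open>e\<^sup>u\<close> with
  \<open>u = b\<^sub>1 b\<^sub>2 x t\<close> to the first factor and \<open>e\<^sup>-\<^sup>u\<close> to the second, and these cancel.
\<close>

text \<open>The exponential generating function of the Bernoulli polynomials, with argument \<open>x\<close>.\<close>

definition bernpoly_egf :: "real \<Rightarrow> real fps" where
  "bernpoly_egf x = Abs_fps (\<lambda>n. bernpoly n x / fact n)"

lemma bernpoly_egf_add: "bernpoly_egf (x + h) = bernpoly_egf x * fps_exp h"
proof -
  have "fps_nth (fps_exp 1 - 1 :: real fps) 1 \<noteq> 0"
    by simp
  hence nz: "fps_exp 1 - 1 \<noteq> (0 :: real fps)"
    by (metis fps_zero_nth)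
  have "bernpoly_egf (x + h) * (fps_exp 1 - 1) = bernpoly_egf x * fps_exp h * (fps_exp 1 - 1)"
    using bernpoly_fps_real[of "x + h"] bernpoly_fps_real[of x]
    by (simp add: bernpoly_egf_def fps_exp_add_mult mult_ac)
  thus ?thesis
    using nz by simp
qed

lemma bernpoly_egf_add_compose_linear:
  "bernpoly_egf (x + h) oo (fps_const c * fps_X) =
     (bernpoly_egf x oo (fps_const c * fps_X)) * fps_exp (c * h)"
  by (simp add: bernpoly_egf_add fps_compose_mult_distrib)

text \<open>
  The alternating binomial convolution of the Bernoulli polynomials at \<open>u\<close> and \<open>v\<close>, with weights
  \<open>c\<^sup>k d\<^sup>N\<^sup>-\<^sup>k\<close>. The sum \<open>S(x)\<close> above is
  \<open>bernpoly_conv N b1 b2 (b1 * x + y1) (b2 * x + y2)\<close>.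
\<close>

definition bernpoly_conv :: "nat \<Rightarrow> real \<Rightarrow> real \<Rightarrow> real \<Rightarrow> real \<Rightarrow> real" where
  "bernpoly_conv N c d u v =
     (\<Sum>k=0..N. (-1) ^ k * real (N choose k) * c ^ k * d ^ (N - k) * bernpoly (N - k) u * bernpoly k v)"

lemma bernpoly_conv_egf:
  "bernpoly_conv N c d u v =
     fact N * fps_nth ((bernpoly_egf v oo (fps_const (-c) * fps_X)) *
                       (bernpoly_egf u oo (fps_const d * fps_X))) N"
  unfolding bernpoly_conv_def fps_compose_linear fps_mult_nth sum_distrib_left
proof (intro sum.cong refl)
  fix k assume "k \<in> {0..N}"
  hence "real (N choose k) = fact N / (fact k * fact (N - k))"
    by (simp add: binomial_fact)
  thus "(-1) ^ k * real (N choose k) * c ^ k * d ^ (N - k) * bernpoly (N - k) u * bernpoly k v =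
      fact N * (fps_nth (Abs_fps (\<lambda>n. (-c) ^ n * fps_nth (bernpoly_egf v) n)) k *
                fps_nth (Abs_fps (\<lambda>n. d ^ n * fps_nth (bernpoly_egf u) n)) (N - k))"
    by (simp add: bernpoly_egf_def power_minus[of c])
qed

text \<open>
  Shifting \<open>u\<close> and \<open>v\<close> by multiples of \<open>c\<close> and \<open>d\<close> in the same ratio multiplies the two generating
  functions by mutually inverse exponentials.
\<close>

lemma bernpoly_conv_shift:
  "bernpoly_conv N c d (u + c * x) (v + d * x) = bernpoly_conv N c d u v"
proof -
  define P where "P = bernpoly_egf v oo (fps_const (-c) * fps_X)"
  define Q where "Q = bernpoly_egf u oo (fps_const d * fps_X)"
  have "-c * (d * x) + d * (c * x) = 0"
    by simp
  hence "fps_exp (-c * (d * x)) * fps_exp (d * (c * x)) = (1 :: real fps)"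
    by (simp only: fps_exp_add_mult [symmetric] fps_exp_0)
  moreover have "(P * fps_exp (-c * (d * x))) * (Q * fps_exp (d * (c * x))) =
      P * Q * (fps_exp (-c * (d * x)) * fps_exp (d * (c * x)))"
    by (simp only: mult_ac)
  ultimately have "(P * fps_exp (-c * (d * x))) * (Q * fps_exp (d * (c * x))) = P * Q"
    by (simp only: mult_1_right)
  thus ?thesis
    by (simp only: bernpoly_conv_egf bernpoly_egf_add_compose_linear P_def Q_def)
qed

text \<open>
  The two truncated sums are the parts of one convolution with index above \<open>m\<close> and at most \<open>m\<close>;
  no relation between \<open>u\<close> and \<open>v\<close> is needed for this.
\<close>

lemma bernpoly_conv_split:
  fixes b1 b2 u v :: real and m n :: nat
  assumes "b1 \<noteq> 0" and "b2 \<noteq> 0"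
  shows "(\<Sum>a=0..n. (-1) ^ a * real ((m + n + 1) choose (n - a)) * b1 ^ a * b2 powi (- int a - 1)
            * bernpoly (n - a) u * bernpoly (m + a + 1) v)
       - (\<Sum>a=0..m. (-1) ^ a * real ((m + n + 1) choose (m - a)) * b2 ^ a * b1 powi (- int a - 1)
            * bernpoly (m - a) v * bernpoly (n + a + 1) u)
       = (-1) ^ (m + 1) / (b1 ^ (m + 1) * b2 ^ (n + 1)) * bernpoly_conv (m + n + 1) b1 b2 u v"
    (is "?A - ?B = ?c * _")
proof -
  define w where
    "w k = real ((m + n + 1) choose k) * bernpoly (m + n + 1 - k) u * bernpoly k v" for k
  define f where "f k = (-1) ^ k * b1 ^ k * b2 ^ (m + n + 1 - k) * w k" for k
  have powi: "b powi (- int a - 1) = 1 / b ^ Suc a" if "b \<noteq> 0" for b :: real and a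
  proof -
    have "- int a - 1 = - int (Suc a)"
      by simp
    thus ?thesis
      by (simp only: power_int_minus power_int_of_nat inverse_eq_divide)
  qed
  have A: "?A = ?c * (\<Sum>a=0..n. f (m + 1 + a))"
    unfolding sum_distrib_left
  proof (intro sum.cong refl)
    fix a assume "a \<in> {0..n}"
    then obtain r where r: "n = a + r"
      by (auto simp: le_iff_add)
    have "(m + n + 1) choose (n - a) = (m + n + 1) choose (m + 1 + a)"
      by (subst binomial_symmetric) (auto simp: r)
    moreover have "m + n + 1 - (m + 1 + a) = n - a" and "m + 1 + a = m + a + 1"
      by simp_all
    ultimately have "(-1) ^ a * real ((m + n + 1) choose (n - a)) * b1 ^ a * b2 powi (- int a - 1)
            * bernpoly (n - a) u * bernpoly (m + a + 1) v =
        (-1) ^ a * b1 ^ a * b2 powi (- int a - 1) * w (m + 1 + a)"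
      by (simp only: w_def mult_ac)
    also have "(-1) ^ a * b1 ^ a * b2 powi (- int a - 1) =
        ?c * ((-1) ^ (m + 1 + a) * b1 ^ (m + 1 + a) * b2 ^ (m + n + 1 - (m + 1 + a)))"
      using assms by (simp add: powi r power_add)
    finally show "(-1) ^ a * real ((m + n + 1) choose (n - a)) * b1 ^ a * b2 powi (- int a - 1)
            * bernpoly (n - a) u * bernpoly (m + a + 1) v = ?c * f (m + 1 + a)"
      by (simp only: f_def mult.assoc)
  qed
  have B: "- ?B = ?c * (\<Sum>a=0..m. f (m - a))"
    unfolding sum_distrib_left sum_negf [symmetric]
  proof (intro sum.cong refl)
    fix a assume "a \<in> {0..m}"
    then obtain r where r: "m = a + r"
      by (auto simp: le_iff_add)
    have "m + n + 1 - (m - a) = n + a + 1"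
      by (simp add: r)
    hence "- ((-1) ^ a * real ((m + n + 1) choose (m - a)) * b2 ^ a * b1 powi (- int a - 1)
            * bernpoly (m - a) v * bernpoly (n + a + 1) u) =
        - ((-1) ^ a * b2 ^ a * b1 powi (- int a - 1)) * w (m - a)"
      by (simp only: w_def mult_ac mult_minus_left mult_minus_right)
    also have "- ((-1) ^ a * b2 ^ a * b1 powi (- int a - 1)) =
        ?c * ((-1) ^ (m - a) * b1 ^ (m - a) * b2 ^ (m + n + 1 - (m - a)))"
      using assms by (simp add: powi r power_add)
    finally show "- ((-1) ^ a * real ((m + n + 1) choose (m - a)) * b2 ^ a * b1 powi (- int a - 1)
            * bernpoly (m - a) v * bernpoly (n + a + 1) u) = ?c * f (m - a)"
      by (simp only: f_def mult.assoc)
  qed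
  have "bernpoly_conv (m + n + 1) b1 b2 u v = (\<Sum>k=0..m + (n + 1). f k)"
    by (simp add: bernpoly_conv_def f_def w_def add.assoc mult_ac)
  also have "\<dots> = (\<Sum>k=0..m. f k) + (\<Sum>k=m+1..m+(n+1). f k)"
    by (rule sum.ub_add_nat) simp
  also have "(\<Sum>k=0..m. f k) = (\<Sum>a=0..m. f (m - a))"
    by (simp add: sum.atLeastAtMost_rev[of f 0 m])
  also have "(\<Sum>k=m+1..m+(n+1). f k) = (\<Sum>a=0..n. f (m + 1 + a))"
    using sum.shift_bounds_cl_nat_ivl[of f 0 "m + 1" n] by (simp add: add_ac)
  finally show ?thesis
    using A B by (simp add: distrib_left)
qed

theorem corollary4:
  fixes b1 b2 y1 y2 x :: real and n m :: nat
  assumes "b1 \<noteq> 0" and "b2 \<noteq> 0"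
  shows "(\<Sum>a=0..n. (-1) ^ a * real ((m + n + 1) choose (n - a)) * b1 ^ a * b2 powi (- int a - 1)
            * bernpoly (n - a) (b1 * x + y1) * bernpoly (m + a + 1) (b2 * x + y2))
       - (\<Sum>a=0..m. (-1) ^ a * real ((m + n + 1) choose (m - a)) * b2 ^ a * b1 powi (- int a - 1)
            * bernpoly (m - a) (b2 * x + y2) * bernpoly (n + a + 1) (b1 * x + y1))
       = (-1) ^ (m + 1) / (b1 ^ (m + 1) * b2 ^ (n + 1))
         * (\<Sum>a=0..m+n+1. (-1) ^ a * real ((m + n + 1) choose a) * b1 ^ a * b2 ^ (m + n + 1 - a)
            * bernpoly (m + n + 1 - a) y1 * bernpoly a y2)"
  unfolding bernpoly_conv_split[OF assms] bernpoly_conv_def[symmetric]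
  using bernpoly_conv_shift[of "m + n + 1" b1 b2 y1 x y2] by (simp add: add.commute)

end
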